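(* Let $H$ be a weighted graph with no loops, and let $a\in V(H)$ have $\alpha(a)=\beta(a)=1$. Then for every composition $H\ast K$ (with $K$ any weighted graph such that $H\ast K$ is defined), $q(H\ast K)=q(K')$, where $K'$ is obtained from $K$ by giving $a$ the weights \[ \alpha(a)=\frac{q(H)-y\,q(H-a)}{(x-1)^{2}-(y-1)^{2}},\qquad \beta(a)=\frac{((x-1)^{2}+y-1)\,q(H-a)-(y-1)\,q(H)}{(x-1)^{2}-(y-1)^{2}}. \]
   Context: All graphs are finite and may have loops (at most one per vertex) but no multiple edges. The adjacency matrix of a graph is the symmetric $0/1$ matrix over $GF(2)$ whose diagonal entry at $v$ is $1$ iff $v$ is looped; $r(G)$, $n(G)$ are its rank and nullity over $GF(2)$ (empty graph: $r=n=0$). For $S\subseteq V(G)$, $G[S]$ is the induced subgraph. Let $A$ be a commutative ring with unity containing elements $x,y$ such that $(x-1)^2-(y-1)^2$ is invertible in $A$ (e.g. a field of rational functions in $x,y$). A weighted graph is a graph $G$ with functions $\alpha,\beta:V(G)\to A$, and \[ q(G)=\sum_{S\subseteq V(G)}\Big(\prod_{s\in S}\alpha(s)\Big)\Big(\prod_{v\notin S}\beta(v)\Big)(x-1)^{r(G[S])}(y-1)^{n(G[S])}. \] Deleting a vertex leaves the other weights unchanged. Composition: a weighted graph $G=H\ast K$ is the composition of weighted graphs $H$ and $K$ if (a) $V(H)\cap V(K)=\{a\}$ with $a$ unlooped in both $H$ and $K$; (b) $\alpha(a)=\beta(a)=1$ in both $H$ and $K$; (c) $V(G)=(V(H)\cup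 V(K))\setminus\{a\}$ and vertices of $G$ inherit their weights (and loops) from $H$ and $K$; (d) the edges of $G$ are the edges of $H-a$, the edges of $K-a$, and the edges $vw$ for all $v\in V(K)\setminus\{a\}$ adjacent to $a$ in $K$ and $w\in V(H)\setminus\{a\}$ adjacent to $a$ in $H$. *)

theory Defs
  imports
    "HOL-Library.Z2"
    "Jordan_Normal_Form.Matrix_Kernel"
    "Jordan_Normal_Form.DL_Rank"
begin

text \<open>
  An edge is the set of its endpoints, so a loop at \<open>v\<close> is the edge \<open>{v} = {v, v}\<close>. This allows at
  most one loop per vertex and excludes multiple edges.
  The values of the weights \<open>\<alpha>\<close> and \<open>\<beta>\<close> outside the vertex set are irrelevant.
\<close>

record ('v, 'r) wgraph =
  verts :: "'v set"
  edges :: "'v set set"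
  \<alpha> :: "'v \<Rightarrow> 'r"
  \<beta> :: "'v \<Rightarrow> 'r"

definition is_wgraph :: "('v, 'r) wgraph \<Rightarrow> bool" where
  "is_wgraph G \<longleftrightarrow>
     finite (verts G) \<and> (\<forall>e \<in> edges G. \<exists>v \<in> verts G. \<exists>w \<in> verts G. e = {v, w})"

definition adjacent :: "('v, 'r) wgraph \<Rightarrow> 'v \<Rightarrow> 'v \<Rightarrow> bool" where
  "adjacent G v w \<longleftrightarrow> {v, w} \<in> edges G"

definition looped :: "('v, 'r) wgraph \<Rightarrow> 'v \<Rightarrow> bool" where
  "looped G v \<longleftrightarrow> adjacent G v v"

definition induced :: "('v, 'r) wgraph \<Rightarrow> 'v set \<Rightarrow> ('v, 'r) wgraph" where
  "induced G S = G\<lparr>verts := S, edges := {e \<in> edges G. e \<subseteq> S}\<rparr>"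

definition delete_vertex :: "('v, 'r) wgraph \<Rightarrow> 'v \<Rightarrow> ('v, 'r) wgraph" where
  "delete_vertex G a = induced G (verts G - {a})"

text \<open>
  The adjacency matrix over \<open>GF(2)\<close> is taken with respect to an arbitrary enumeration of the
  (finite) vertex set. Another enumeration permutes rows and columns simultaneously, which changes
  neither the rank nor the nullity.
\<close>

definition vertex_list :: "('v, 'r) wgraph \<Rightarrow> 'v list" where
  "vertex_list G = (SOME vs. distinct vs \<and> set vs = verts G)"

definition adj_matrix :: "('v, 'r) wgraph \<Rightarrow> bit mat" where
  "adj_matrix G =
     (let vs = vertex_list G; n = length vs
      in mat n n (\<lambda>(i, j). if adjacent G (vs ! i) (vs ! j) then 1 else 0))"

definition graph_rank :: "('v, 'r) wgraph \<Rightarrow> nat" where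
  "graph_rank G = vec_space.rank (dim_row (adj_matrix G)) (adj_matrix G)"

definition graph_nullity :: "('v, 'r) wgraph \<Rightarrow> nat" where
  "graph_nullity G = kernel_dim (adj_matrix G)"

definition q :: "'r::comm_ring_1 \<Rightarrow> 'r \<Rightarrow> ('v, 'r) wgraph \<Rightarrow> 'r" where
  "q x y G =
     (\<Sum>S \<in> Pow (verts G).
        (\<Prod>s \<in> S. \<alpha> G s) * (\<Prod>v \<in> verts G - S. \<beta> G v)
        * (x - 1) ^ graph_rank (induced G S) * (y - 1) ^ graph_nullity (induced G S))"

text \<open>
  \<open>is_composition a H K G\<close> means \<open>G = H * K\<close>, where \<open>a\<close> is the common vertex of \<open>H\<close> and \<open>K\<close>.
  Loops are edges, so they are inherited through the equation for \<open>edges G\<close>.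
\<close>

definition is_composition ::
  "'v \<Rightarrow> ('v, 'r::comm_ring_1) wgraph \<Rightarrow> ('v, 'r) wgraph \<Rightarrow> ('v, 'r) wgraph \<Rightarrow> bool" where
  "is_composition a H K G \<longleftrightarrow>
     is_wgraph H \<and> is_wgraph K \<and> is_wgraph G \<and>
     verts H \<inter> verts K = {a} \<and> \<not> looped H a \<and> \<not> looped K a \<and>
     \<alpha> H a = 1 \<and> \<beta> H a = 1 \<and> \<alpha> K a = 1 \<and> \<beta> K a = 1 \<and>
     verts G = (verts H \<union> verts K) - {a} \<and>
     (\<forall>v \<in> verts H - {a}. \<alpha> G v = \<alpha> H v \<and> \<beta> G v = \<beta> H v) \<and>
     (\<forall>v \<in> verts K - {a}. \<alpha> G v = \<alpha> K v \<and> \<beta> G v = \<beta> K v) \<and>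
     edges G = edges (delete_vertex H a) \<union> edges (delete_vertex K a) \<union>
       {{v, w} | v w. v \<in> verts K - {a} \<and> adjacent K v a \<and>
                      w \<in> verts H - {a} \<and> adjacent H w a}"

definition reweight :: "('v, 'r) wgraph \<Rightarrow> 'v \<Rightarrow> 'r \<Rightarrow> 'r \<Rightarrow> ('v, 'r) wgraph" where
  "reweight G a s t = G\<lparr>\<alpha> := (\<alpha> G)(a := s), \<beta> := (\<beta> G)(a := t)\<rparr>"

end

(*
  For S a set of vertices of H - a, let A be the adjacency matrix of H[S] and b the neighbourhood
  vector of a in S. Over GF(2) the loopless matrix A is alternating. If b = A u, then u^T A u = 0, and
  adding a to S keeps the rank while the blocks of (H * K)[S + T] decouple into H[S] and K[T].
  Otherwise some z in the kernel of A has b^T z = 1; then adding a to S raises the rank by 2, and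
  H[S] contributes its rank to (H * K)[S + T], which otherwise behaves like K[T + a]. So S enters
  q(H * K) as a multiple of the terms of K' in which a is absent (first case) or present (second
  case), and the same two totals express q(H) and q(H - a); the weights of a in K' solve this 2 by 2
  linear system. All nullities are computed by counting kernels, which have 2^nullity elements.
*)

theory Submission
  imports Defs
begin

section \<open>Rank, nullity and the size of the kernel\<close>

text \<open>Coordinates with respect to a finite basis are unique, so vectors correspond to
  functions from the basis to the field. Over GF(2) this lets a nullity be read off from the size of
  a kernel.\<close>

lemma (in vectorspace) card_carrier_eq_power_dim:
  assumes "finite B" "basis B"
  shows "card (carrier V) = card (carrier K) ^ dim"
proof -
  have B: "B \<subseteq> carrier V" using assms(2) unfolding basis_def by blast
  have rep: "\<exists>!a. a \<in> B \<rightarrow>\<^sub>E carrier K \<and> lincomb a B = v" if "v \<in> carrier V" for v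
    using basis_criterion[OF assms(1) B] assms(2) that by blast
  have cl: "lincomb a B \<in> carrier V" if "a \<in> B \<rightarrow>\<^sub>E carrier K" for a
    using that B by (intro lincomb_closed) auto
  have "bij_betw (\<lambda>a. lincomb a B) (B \<rightarrow>\<^sub>E carrier K) (carrier V)"
    unfolding bij_betw_def
  proof
    show "inj_on (\<lambda>a. lincomb a B) (B \<rightarrow>\<^sub>E carrier K)"
      using rep cl by (intro inj_onI) metis
    show "(\<lambda>a. lincomb a B) ` (B \<rightarrow>\<^sub>E carrier K) = carrier V"
      using rep cl by (auto simp: image_iff) metis
  qed
  then have "card (carrier V) = card (B \<rightarrow>\<^sub>E carrier K)"
    by (simp add: bij_betw_same_card)
  then show ?thesis
    using assms by (simp add: card_funcsetE dim_basis)
qed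

lemma card_mat_kernel:
  fixes A :: "'a::field mat"
  shows "card (mat_kernel A) = card (UNIV :: 'a set) ^ kernel_dim A"
proof -
  interpret kernel "dim_row A" "dim_col A" A by unfold_locales simp
  obtain B where "finite B" "basis B"
    using kernel_basis_exists[of A "dim_row A" "dim_col A"] by auto
  from Ker.card_carrier_eq_power_dim[OF this] show ?thesis
    by simp
qed

text \<open>Rank-nullity for the map taking v to A v: its kernel is \<open>mat_kernel A\<close> and
  its image is the span of the columns. Ranks can therefore be derived later from nullities
  alone.\<close>

lemma rank_plus_kernel_dim:
  fixes A :: "'a::field mat"
  shows "vec_space.rank (dim_row A) A + kernel_dim A = dim_col A"
proof -
  define nr nc where "nr = dim_row A" and "nc = dim_col A"
  have A: "A \<in> carrier_mat nr nc" by (simp add: nr_def nc_def)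
  interpret V: vec_space "TYPE('a)" nc .
  interpret W: vec_space "TYPE('a)" nr .
  let ?T = "\<lambda>v. A *\<^sub>v v"
  have mh: "mod_hom class_ring V.V W.V ?T"
  proof (intro mod_hom.intro mod_hom_axioms.intro vec_module)
    show "?T \<in> LinearCombinations.module_hom class_ring V.V W.V"
      using A by (auto simp: LinearCombinations.module_hom_def module_vec_simps class_ring_simps
          mult_add_distrib_mat_vec mult_mat_vec)
  qed
  then have lm: "linear_map class_ring V.V W.V ?T"
    by (intro linear_map.intro vec_vs)
  have k: "mod_hom.ker V.V W.V ?T = mat_kernel A"
    unfolding mod_hom.ker_def[OF mh] mat_kernel[OF A] by (auto simp: module_vec_simps)
  have i: "mod_hom.im V.V ?T = W.span (set (cols A))"
    unfolding mod_hom.im_def[OF mh] W.col_space_def[symmetric] W.col_space_eq[OF A]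
    using A by (auto simp: module_vec_simps)
  have "vectorspace.dim class_ring (W.V\<lparr>carrier := W.span (set (cols A))\<rparr>)
      + vectorspace.dim class_ring (V.V\<lparr>carrier := mat_kernel A\<rparr>) = nc"
    using linear_map.rank_nullity[OF lm V.fin_dim] unfolding k i V.dim_is_n .
  then show ?thesis
    unfolding kernel_dim_def nr_def nc_def vec_space.rank_def .
qed

section \<open>Kernels of symmetric block matrices over GF(2)\<close>

text \<open>The default simplification rules would rewrite field operations on \<open>bit\<close> to bitwise ones.\<close>

declare add_bit_eq_xor [simp del] mult_bit_eq_and [simp del]

text \<open>Induction on the number of rows. If b does not vanish on the common kernel of the rows
  in \<open>I\<close>, a suitable multiple of the new row \<open>M j\<close> is subtracted from b to
  make it vanish there.\<close>

lemma functional_in_span: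
  fixes M :: "'i \<Rightarrow> 'v \<Rightarrow> 'a::field"
  assumes "finite I" and "finite S"
    and "\<And>z. (\<forall>i\<in>I. (\<Sum>v\<in>S. M i v * z v) = 0) \<Longrightarrow> (\<Sum>v\<in>S. b v * z v) = 0"
  shows "\<exists>u. \<forall>v\<in>S. b v = (\<Sum>i\<in>I. u i * M i v)"
  using assms(1,3)
proof (induction I arbitrary: b)
  case empty
  have "b v = 0" if "v \<in> S" for v
    using empty(1)[of "\<lambda>w. if w = v then 1 else 0"] that assms(2)
    by (simp add: if_distrib cong: if_cong)
  then show ?case by simp
next
  case (insert j I)
  show ?case
  proof (cases "\<forall>z. (\<forall>i\<in>I. (\<Sum>v\<in>S. M i v * z v) = 0) \<longrightarrow> (\<Sum>v\<in>S. b v * z v) = 0")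
    case True
    then obtain u where u: "\<forall>v\<in>S. b v = (\<Sum>i\<in>I. u i * M i v)"
      using insert.IH[of b] by blast
    have "\<forall>v\<in>S. b v = (\<Sum>i\<in>insert j I. (u(j := 0)) i * M i v)"
      using u insert.hyps by (auto intro!: sum.cong)
    then show ?thesis by blast
  next
    case False
    then obtain z where z: "\<forall>i\<in>I. (\<Sum>v\<in>S. M i v * z v) = 0" and bz: "(\<Sum>v\<in>S. b v * z v) \<noteq> 0"
      by blast
    define p where "p = (\<Sum>v\<in>S. M j v * z v)"
    have p: "p \<noteq> 0" using insert.prems[of z] z bz by (auto simp: p_def)
    \<comment> \<open>This value makes b - k \<open>M j\<close> vanish at z.\<close>
    define k where "k = (\<Sum>v\<in>S. b v * z v) / p"
    have "(\<Sum>v\<in>S. (b v - k * M j v) * w v) = 0" if w: "\<forall>i\<in>I. (\<Sum>v\<in>S. M i v * w v) = 0" for w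
    proof -
      \<comment> \<open>With this t the vector w - t z is annihilated by row j as well, so the
        hypothesis on b applies to it.\<close>
      define t where "t = (\<Sum>v\<in>S. M j v * w v) / p"
      have e: "(\<Sum>v\<in>S. c v * (w v - t * z v)) = (\<Sum>v\<in>S. c v * w v) - t * (\<Sum>v\<in>S. c v * z v)" for c
        by (simp add: right_diff_distrib sum_subtractf sum_distrib_left mult_ac)
      have "(\<Sum>v\<in>S. b v * (w v - t * z v)) = 0"
      proof (rule insert.prems, rule ballI)
        fix i assume "i \<in> insert j I"
        then show "(\<Sum>v\<in>S. M i v * (w v - t * z v)) = 0"
          unfolding e using z w p by (auto simp: t_def p_def[symmetric])
      qed
      then have "(\<Sum>v\<in>S. b v * w v) = k * (\<Sum>v\<in>S. M j v * w v)"
        unfolding e using p by (simp add: t_def k_def)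
      then show ?thesis
        by (simp add: left_diff_distrib sum_subtractf sum_distrib_left mult.assoc)
    qed
    then obtain u where u: "\<forall>v\<in>S. b v - k * M j v = (\<Sum>i\<in>I. u i * M i v)"
      using insert.IH[of "\<lambda>v. b v - k * M j v"] by blast
    have "\<forall>v\<in>S. b v = (\<Sum>i\<in>insert j I. (u(j := k)) i * M i v)"
    proof
      fix v assume "v \<in> S"
      then have "b v = k * M j v + (\<Sum>i\<in>I. u i * M i v)"
        using u by (simp add: algebra_simps flip: u)
      also have "(\<Sum>i\<in>I. u i * M i v) = (\<Sum>i\<in>I. (u(j := k)) i * M i v)"
        using insert.hyps by (intro sum.cong) auto
      finally show "b v = (\<Sum>i\<in>insert j I. (u(j := k)) i * M i v)"
        using insert.hyps by simp
    qed
    then show ?thesis by blast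
  qed
qed

lemma bit_add_self [simp]: "x + x = 0" "x + (x + y) = y" for x y :: bit
  by (cases x; simp add: add.assoc[symmetric])+

lemma card_UNIV_bit: "card (UNIV :: bit set) = 2"
proof -
  have "(UNIV :: bit set) = {0, 1}" by (auto intro: bit.exhaust)
  then show ?thesis by (metis card_2_iff zero_neq_one)
qed

text \<open>Vectors are functions on the vertices, so no enumeration is involved. Forcing the value
  0 outside \<open>S\<close> makes each kernel vector count exactly once.\<close>

definition null_space :: "'v set \<Rightarrow> ('v \<Rightarrow> 'v \<Rightarrow> bit) \<Rightarrow> ('v \<Rightarrow> bit) set" where
  "null_space S M =
     {f. (\<forall>v. v \<notin> S \<longrightarrow> f v = 0) \<and> (\<forall>v\<in>S. (\<Sum>w\<in>S. M v w * f w) = 0)}"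

text \<open>Moves M from one argument of the bilinear form to the other, so that knowledge of M x
  can be used where M y occurs.\<close>

lemma sum_symmetric_adjoint:
  fixes M :: "'v \<Rightarrow> 'v \<Rightarrow> 'a::comm_ring"
  assumes "\<And>v w. v \<in> S \<Longrightarrow> w \<in> S \<Longrightarrow> M v w = M w v"
  shows "(\<Sum>v\<in>S. x v * (\<Sum>w\<in>S. M v w * y w)) = (\<Sum>w\<in>S. y w * (\<Sum>v\<in>S. M w v * x v))"
proof -
  have "(\<Sum>v\<in>S. x v * (\<Sum>w\<in>S. M v w * y w)) = (\<Sum>v\<in>S. \<Sum>w\<in>S. x v * (M v w * y w))"
    by (simp add: sum_distrib_left)
  also have "\<dots> = (\<Sum>w\<in>S. \<Sum>v\<in>S. x v * (M v w * y w))"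
    by (rule sum.swap)
  also have "\<dots> = (\<Sum>w\<in>S. y w * (\<Sum>v\<in>S. M w v * x v))"
    using assms by (auto simp: sum_distrib_left mult_ac intro!: sum.cong)
  finally show ?thesis .
qed

text \<open>The terms for (v, w) and (w, v) agree by symmetry and cancel in characteristic 2; the
  diagonal terms vanish. The absence of loops in H enters through the zero diagonal.\<close>

lemma alternating_form_eq_0:
  fixes M :: "'v \<Rightarrow> 'v \<Rightarrow> bit"
  assumes "finite S"
    and "\<And>v w. v \<in> S \<Longrightarrow> w \<in> S \<Longrightarrow> M v w = M w v" and "\<And>v. v \<in> S \<Longrightarrow> M v v = 0"
  shows "(\<Sum>v\<in>S. u v * (\<Sum>w\<in>S. M v w * u w)) = 0"
  using assms
proof (induction S)
  case empty
  then show ?case by simp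
next
  case (insert x S)
  let ?r = "\<Sum>w\<in>S. M x w * u w"
  have "(\<Sum>v\<in>S. u v * (M v x * u x)) = u x * ?r"
    using insert.prems by (auto simp: sum_distrib_left mult_ac intro!: sum.cong)
  then have "(\<Sum>v\<in>insert x S. u v * (\<Sum>w\<in>insert x S. M v w * u w)) =
     u x * ?r + (u x * ?r + (\<Sum>v\<in>S. u v * (\<Sum>w\<in>S. M v w * u w)))"
    using insert by (simp add: distrib_left sum.distrib)
  then show ?case
    using insert by simp
qed

text \<open>
  Coordinates for the null space of a matrix bordered by one row and column with zero corner: the
  pair consists of the entry at the new index and the remaining entries.
\<close>

definition bordered_null_space ::
  "'v set \<Rightarrow> ('v \<Rightarrow> bit) \<Rightarrow> ('v \<Rightarrow> 'v \<Rightarrow> bit) \<Rightarrow> (bit \<times> ('v \<Rightarrow> bit)) set" where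
  "bordered_null_space T c M =
     {(h, g). (\<forall>v. v \<notin> T \<longrightarrow> g v = 0) \<and> (\<Sum>w\<in>T. c w * g w) = 0 \<and>
       (\<forall>v\<in>T. c v * h + (\<Sum>w\<in>T. M v w * g w) = 0)}"

text \<open>The extra coordinate h becomes the value at \<open>a\<close>. In a composition
  \<open>a\<close> is not a vertex of G, so the extra coordinate has to be created first and is
  attached to the vertex \<open>a\<close> of K only here.\<close>

lemma card_bordered_null_space:
  assumes "finite T" and "a \<notin> T" and "M a a = 0"
    and "\<And>t. t \<in> T \<Longrightarrow> M a t = c t" and "\<And>t. t \<in> T \<Longrightarrow> M t a = c t"
  shows "card (bordered_null_space T c M) = card (null_space (insert a T) M)"
proof -
  have "bij_betw (\<lambda>(h, g). g(a := h)) (bordered_null_space T c M) (null_space (insert a T) M)"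
  proof (rule bij_betw_byWitness[where f' = "\<lambda>f. (f a, f(a := 0))"])
    have upd: "(\<Sum>w\<in>T. N w * (g(a := h)) w) = (\<Sum>w\<in>T. N w * g w)" for N g and h :: bit
      using assms(2) by (intro sum.cong) auto
    show "\<forall>p\<in>bordered_null_space T c M. (\<lambda>f. (f a, f(a := 0))) ((\<lambda>(h, g). g(a := h)) p) = p"
      using assms(2) by (auto simp: bordered_null_space_def fun_eq_iff)
    show "\<forall>f\<in>null_space (insert a T) M. (\<lambda>(h, g). g(a := h)) (f a, f(a := 0)) = f"
      by (auto simp: fun_eq_iff)
    show "(\<lambda>(h, g). g(a := h)) ` bordered_null_space T c M \<subseteq> null_space (insert a T) M"
      using assms(1-3) by (auto simp: bordered_null_space_def null_space_def upd assms(4,5)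
          simp del: fun_upd_apply) auto
    show "(\<lambda>f. (f a, f(a := 0))) ` null_space (insert a T) M \<subseteq> bordered_null_space T c M"
      using assms(1-3) by (auto simp: bordered_null_space_def null_space_def upd assms(4,5)
          simp del: fun_upd_apply) auto
  qed
  then show ?thesis by (rule bij_betw_same_card)
qed

section \<open>Null spaces of matrices whose off-diagonal block has rank one\<close>

context
  fixes S T :: "'v set" and M :: "'v \<Rightarrow> 'v \<Rightarrow> bit" and b c :: "'v \<Rightarrow> bit"
  assumes fin: "finite S" "finite T" and disj: "S \<inter> T = {}"
    and symm: "\<And>v w. v \<in> S \<Longrightarrow> w \<in> S \<Longrightarrow> M v w = M w v"
    and ST: "\<And>s t. s \<in> S \<Longrightarrow> t \<in> T \<Longrightarrow> M s t = b s * c t"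
    and TS: "\<And>s t. s \<in> S \<Longrightarrow> t \<in> T \<Longrightarrow> M t s = b s * c t"
begin

text \<open>Because the off-diagonal block is the outer product of b and c, the two parts of f
  interact only through the scalars b^T f on \<open>S\<close> and c^T f on \<open>T\<close>.\<close>

lemma null_space_Un_iff:
  "f \<in> null_space (S \<union> T) M \<longleftrightarrow> (\<forall>v. v \<notin> S \<union> T \<longrightarrow> f v = 0) \<and>
    (\<forall>v\<in>S. (\<Sum>w\<in>S. M v w * f w) + b v * (\<Sum>w\<in>T. c w * f w) = 0) \<and>
    (\<forall>v\<in>T. c v * (\<Sum>w\<in>S. b w * f w) + (\<Sum>w\<in>T. M v w * f w) = 0)"
proof -
  have "(\<Sum>w\<in>S \<union> T. M v w * f w) = (\<Sum>w\<in>S. M v w * f w) + (\<Sum>w\<in>T. M v w * f w)" for v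
    using fin disj by (rule sum.union_disjoint)
  moreover have "(\<Sum>w\<in>T. M v w * f w) = b v * (\<Sum>w\<in>T. c w * f w)" if "v \<in> S" for v
    using that by (simp add: sum_distrib_left ST mult.assoc)
  moreover have "(\<Sum>w\<in>S. M v w * f w) = c v * (\<Sum>w\<in>S. b w * f w)" if "v \<in> T" for v
    using that by (simp add: sum_distrib_left TS mult_ac)
  ultimately show ?thesis
    by (simp add: null_space_def ball_Un)
qed

lemma sum_if_left: "(\<Sum>w\<in>S. N w * (if w \<in> S then x w else y w)) = (\<Sum>w\<in>S. N w * x w :: bit)"
  by (intro sum.cong) auto

lemma sum_if_right: "(\<Sum>w\<in>T. N w * (if w \<in> S then x w else y w)) = (\<Sum>w\<in>T. N w * y w :: bit)"
  using disj by (intro sum.cong) auto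

lemma sum_add_scaled:
  "(\<Sum>w\<in>S. N w * (x w + k * y w)) = (\<Sum>w\<in>S. N w * x w) + k * (\<Sum>w\<in>S. N w * y w :: bit)"
  by (simp add: distrib_left sum.distrib sum_distrib_left mult_ac)

text \<open>
  If \<open>b = A u\<close> for the block \<open>A\<close> of \<open>S\<close>, clearing the off-diagonal blocks with \<open>u\<close> does not change
  the block of \<open>T\<close>, because \<open>A\<close> is alternating and hence \<open>u\<^sup>T A u = 0\<close>.
\<close>

lemma card_null_space_Un_range:
  assumes zero_diag: "\<And>v. v \<in> S \<Longrightarrow> M v v = 0"
    and u: "\<And>v. v \<in> S \<Longrightarrow> b v = (\<Sum>w\<in>S. M v w * u w)"
  shows "card (null_space (S \<union> T) M) = card (null_space S M) * card (null_space T M)"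
proof -
  \<comment> \<open>Since b = M u on \<open>S\<close>, the scalar b^T x equals u^T M x.\<close>
  have bx: "(\<Sum>v\<in>S. b v * x v) = (\<Sum>w\<in>S. u w * (\<Sum>v\<in>S. M w v * x v))" for x
    using sum_symmetric_adjoint[of S M x u] symm u by (simp add: mult.commute)
  have bu: "(\<Sum>v\<in>S. b v * u v) = 0"
    unfolding bx using alternating_form_eq_0[OF fin(1) symm zero_diag] by simp
  \<comment> \<open>With k = c^T f on \<open>T\<close>, the map adds k u to the \<open>S\<close>
    part and keeps the \<open>T\<close> part. The \<open>T\<close> part still determines k, and
    adding k u twice gives 0, so the inverse makes the same correction.\<close>
  define F where "F f =
    ((\<lambda>v. if v \<in> S then f v + (\<Sum>w\<in>T. c w * f w) * u v else 0), (\<lambda>v. if v \<in> S then 0 else f v))"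
    for f :: "'v \<Rightarrow> bit"
  define F' where "F' p =
    (\<lambda>v. if v \<in> S then fst p v + (\<Sum>w\<in>T. c w * snd p w) * u v else snd p v)"
    for p :: "('v \<Rightarrow> bit) \<times> ('v \<Rightarrow> bit)"
  have "bij_betw F (null_space (S \<union> T) M) (null_space S M \<times> null_space T M)"
  proof (rule bij_betw_byWitness[where f' = F'])
    show "\<forall>f\<in>null_space (S \<union> T) M. F' (F f) = f"
      by (auto simp: F_def F'_def fun_eq_iff sum_if_right add.assoc)
    show "\<forall>p\<in>null_space S M \<times> null_space T M. F (F' p) = p"
      using disj by (auto simp: F_def F'_def fun_eq_iff sum_if_right add.assoc null_space_def)
    show "F ` null_space (S \<union> T) M \<subseteq> null_space S M \<times> null_space T M"
    proof (intro image_subsetI)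
      fix f assume "f \<in> null_space (S \<union> T) M"
      then have f: "\<forall>v. v \<notin> S \<union> T \<longrightarrow> f v = 0"
          "\<forall>v\<in>S. (\<Sum>w\<in>S. M v w * f w) + b v * (\<Sum>w\<in>T. c w * f w) = 0"
          "\<forall>v\<in>T. c v * (\<Sum>w\<in>S. b w * f w) + (\<Sum>w\<in>T. M v w * f w) = 0"
        unfolding null_space_Un_iff by auto
      define k where "k = (\<Sum>w\<in>T. c w * f w)"
      have Mf: "(\<Sum>w\<in>S. M v w * f w) = k * b v" if "v \<in> S" for v
        using f(2) that unfolding k_def
        by (metis bit_add_self(2) add.right_neutral mult.commute)
      \<comment> \<open>The rows of \<open>S\<close> say M f = k b there, so b^T f = u^T M f = k u^T
        b = 0. The rows of \<open>T\<close> then no longer see the \<open>S\<close> part.\<close>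
      have "(\<Sum>v\<in>S. b v * f v) = k * (\<Sum>v\<in>S. b v * u v)"
        unfolding bx[of f] by (simp add: Mf) (simp add: sum_distrib_left mult_ac)
      then have "(\<Sum>v\<in>S. b v * f v) = 0" using bu by simp
      then show "F f \<in> null_space S M \<times> null_space T M"
        using f(1,3) Mf
        by (auto simp: F_def k_def[symmetric] null_space_def sum_if_left sum_if_right sum_add_scaled simp flip: u)
    qed
    show "F' ` (null_space S M \<times> null_space T M) \<subseteq> null_space (S \<union> T) M"
    proof clarify
      fix g h assume g: "g \<in> null_space S M" and h: "h \<in> null_space T M"
      have "(\<Sum>v\<in>S. b v * g v) = 0"
        unfolding bx using g by (simp add: null_space_def)
      moreover define k where "k = (\<Sum>w\<in>T. c w * h w)"
      have "(\<Sum>w\<in>S. M v w * (g w + k * u w)) = b v * k" if "v \<in> S" for v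
        unfolding sum_add_scaled using g u[OF that] that by (simp add: null_space_def mult.commute)
      ultimately show "F' (g, h) \<in> null_space (S \<union> T) M"
        using g h bu unfolding null_space_Un_iff
        by (auto simp: F'_def null_space_def sum_if_left sum_if_right sum_add_scaled[where N = b]
            k_def[symmetric])
    qed
  qed
  then show ?thesis
    using bij_betw_same_card by (force simp: card_cartesian_product)
qed

text \<open>Pairing the rows of \<open>S\<close> with z forces c^T f = 0 on \<open>T\<close>, so the
  \<open>S\<close> part lies in the kernel of its own block. The scalar b^T f on \<open>S\<close>
  then acts as the extra coordinate of the bordered matrix. Shifts by z change this scalar freely,
  so prescribing it keeps half of the kernel of the block; this is the factor 2.\<close>

lemma card_null_space_Un_not_range:
  assumes z: "z \<in> null_space S M" and bz: "(\<Sum>v\<in>S. b v * z v) = 1"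
  shows "2 * card (null_space (S \<union> T) M) = card (null_space S M) * card (bordered_null_space T c M)"
proof -
  let ?b = "\<lambda>f. \<Sum>v\<in>S. b v * f v"
  \<comment> \<open>The extra bit t shifts the \<open>S\<close> part by t z, while h records b^T f
    before the shift. As b^T z = 1, the shifted part has b-value h + t, from which \<open>F'\<close>
    recovers t.\<close>
  define F where "F p =
    ((\<lambda>v. if v \<in> S then fst p v + snd p * z v else 0),
     (?b (fst p), (\<lambda>v. if v \<in> S then 0 else fst p v)))"
    for p :: "('v \<Rightarrow> bit) \<times> bit"
  define F' where "F' p =
    ((\<lambda>v. if v \<in> S then fst p v + (?b (fst p) + fst (snd p)) * z v else snd (snd p) v),
     ?b (fst p) + fst (snd p))"
    for p :: "('v \<Rightarrow> bit) \<times> (bit \<times> ('v \<Rightarrow> bit))"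
  have zM: "(\<Sum>w\<in>S. M v w * z w) = 0" if "v \<in> S" for v
    using z that by (simp add: null_space_def)
  have "bij_betw F (null_space (S \<union> T) M \<times> UNIV) (null_space S M \<times> bordered_null_space T c M)"
  proof (rule bij_betw_byWitness[where f' = F'])
    show "\<forall>p\<in>null_space (S \<union> T) M \<times> UNIV. F' (F p) = p"
      by (auto simp: F_def F'_def fun_eq_iff sum_if_left sum_add_scaled bz add.assoc add.left_commute)
    show "\<forall>p\<in>null_space S M \<times> bordered_null_space T c M. F (F' p) = p"
      using disj
      by (auto simp: F_def F'_def fun_eq_iff sum_if_left sum_add_scaled bz add.assoc
          null_space_def bordered_null_space_def)
    show "F ` (null_space (S \<union> T) M \<times> UNIV) \<subseteq> null_space S M \<times> bordered_null_space T c M"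
    proof (intro image_subsetI, elim SigmaE)
      fix p f and t :: bit assume p: "p = (f, t)" and "f \<in> null_space (S \<union> T) M"
      from this(2) have f: "\<forall>v. v \<notin> S \<union> T \<longrightarrow> f v = 0"
          "\<forall>v\<in>S. (\<Sum>w\<in>S. M v w * f w) + b v * (\<Sum>w\<in>T. c w * f w) = 0"
          "\<forall>v\<in>T. c v * (\<Sum>w\<in>S. b w * f w) + (\<Sum>w\<in>T. M v w * f w) = 0"
        unfolding null_space_Un_iff by auto
      define k where "k = (\<Sum>w\<in>T. c w * f w)"
      have Mf: "(\<Sum>w\<in>S. M v w * f w) = k * b v" if "v \<in> S" for v
        using f(2) that unfolding k_def
        by (metis bit_add_self(2) add.right_neutral mult.commute)
      \<comment> \<open>Evaluate z^T M f in two ways: it is k b^T z by the rows of \<open>S\<close>,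
        and 0 because M z = 0 and M is symmetric.\<close>
      have "k * ?b z = (\<Sum>v\<in>S. z v * (\<Sum>w\<in>S. M v w * f w))"
        by (simp add: Mf) (simp add: sum_distrib_left mult_ac)
      also have "\<dots> = 0"
        using sum_symmetric_adjoint[of S M z f] symm zM by simp
      finally have k: "k = 0"
        by (simp add: bz)
      then have "(\<Sum>w\<in>T. c w * f w) = 0" and "\<And>v. v \<in> S \<Longrightarrow> (\<Sum>w\<in>S. M v w * f w) = 0"
        using Mf by (simp_all add: k_def)
      then show "F p \<in> null_space S M \<times> bordered_null_space T c M"
        using f(1,3) zM unfolding p
        by (auto simp: F_def null_space_def bordered_null_space_def sum_if_left sum_if_right
            sum_add_scaled)
    qed
    show "F' ` (null_space S M \<times> bordered_null_space T c M) \<subseteq> null_space (S \<union> T) M \<times> UNIV"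
    proof (intro image_subsetI, elim SigmaE)
      fix p g r assume p: "p = (g, r)" and g: "g \<in> null_space S M"
        and r: "r \<in> bordered_null_space T c M"
      with p g show "F' p \<in> null_space (S \<union> T) M \<times> UNIV"
        using zM unfolding mem_Times_iff null_space_Un_iff
        by (auto simp: F'_def null_space_def bordered_null_space_def sum_if_left sum_if_right
            sum_add_scaled bz)
    qed
  qed
  then have "card (null_space (S \<union> T) M) * card (UNIV :: bit set) =
      card (null_space S M) * card (bordered_null_space T c M)"
    using bij_betw_same_card by (force simp: card_cartesian_product)
  then show ?thesis by (simp add: card_UNIV_bit)
qed

end

text \<open>By duality, a vector annihilating the kernel lies in the row space, and rows are columns
  by symmetry. This supplies u in the case where no z as above exists.\<close>

lemma symmetric_range_eq_annihilator:
  assumes "finite S" and "\<And>v w. v \<in> S \<Longrightarrow> w \<in> S \<Longrightarrow> M v w = M w v"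
    and "\<And>z. z \<in> null_space S M \<Longrightarrow> (\<Sum>v\<in>S. b v * z v) = 0"
  shows "\<exists>u. \<forall>v\<in>S. b v = (\<Sum>w\<in>S. M v w * u w)"
proof -
  have "\<exists>u. \<forall>v\<in>S. b v = (\<Sum>w\<in>S. u w * M w v)"
  proof (rule functional_in_span[OF assms(1,1)])
    fix z assume z: "\<forall>v\<in>S. (\<Sum>w\<in>S. M v w * z w) = 0"
    have r: "(\<Sum>w\<in>S. N w * (if w \<in> S then z w else 0)) = (\<Sum>w\<in>S. N w * z w)" for N
      by (intro sum.cong) auto
    \<comment> \<open>The vector z is arbitrary outside \<open>S\<close>; truncation puts it into
      \<open>null_space\<close> without changing any sum over \<open>S\<close>.\<close>
    have "(\<lambda>v. if v \<in> S then z v else 0) \<in> null_space S M"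
      using z by (simp add: null_space_def r)
    from assms(3)[OF this] show "(\<Sum>v\<in>S. b v * z v) = 0"
      by (simp add: r)
  qed
  then show ?thesis
    using assms(2) by (auto simp: mult.commute cong: sum.cong)
qed

section \<open>Adjacency matrices and compositions\<close>

definition adj_bit :: "('v, 'r) wgraph \<Rightarrow> 'v \<Rightarrow> 'v \<Rightarrow> bit" where
  "adj_bit G v w = of_bool (adjacent G v w)"

lemma adj_bit_commute: "adj_bit G v w = adj_bit G w v"
  by (simp add: adj_bit_def adjacent_def insert_commute)

lemma vertex_list:
  assumes "finite (verts G)"
  shows "distinct (vertex_list G)" and "set (vertex_list G) = verts G"
proof -
  have "\<exists>vs. distinct vs \<and> set vs = verts G"
    using finite_distinct_list[OF assms] by blast
  then have "distinct (vertex_list G) \<and> set (vertex_list G) = verts G"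
    unfolding vertex_list_def by (rule someI_ex)
  then show "distinct (vertex_list G)" and "set (vertex_list G) = verts G" by blast+
qed

lemma graph_rank_plus_nullity:
  assumes "finite (verts G)"
  shows "graph_rank G + graph_nullity G = card (verts G)"
proof -
  have "dim_col (adj_matrix G) = card (verts G)"
    using vertex_list[OF assms] by (metis adj_matrix_def dim_col_mat(1) distinct_card)
  then show ?thesis
    unfolding graph_rank_def graph_nullity_def rank_plus_kernel_dim .
qed

text \<open>The enumeration \<open>vertex_list\<close> turns functions on the vertices into
  coordinate vectors. The left-hand side does not mention it, so the nullity does not depend on the
  enumeration chosen.\<close>

lemma card_null_space_adj_bit:
  assumes "finite (verts G)"
  shows "card (null_space (verts G) (adj_bit G)) = 2 ^ graph_nullity G"
proof -
  define vs where "vs = vertex_list G"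
  define n where "n = length vs"
  note vs = vertex_list[OF assms, folded vs_def]
  have A: "adj_matrix G = mat n n (\<lambda>(i, j). adj_bit G (vs ! i) (vs ! j))"
    unfolding adj_matrix_def vs_def[symmetric] n_def[symmetric] Let_def
    by (intro cong_mat) (auto simp: adj_bit_def)
  have bij: "bij_betw ((!) vs) {..<n} (verts G)"
    using bij_betw_nth[OF vs(1) refl] vs(2) by (simp add: n_def)
  have sum_vs: "(\<Sum>w\<in>verts G. N w) = (\<Sum>j<n. N (vs ! j))" for N :: "'a \<Rightarrow> bit"
    using sum.reindex_bij_betw[OF bij, of N] by simp
  have all_vs: "(\<forall>v\<in>verts G. Q v) \<longleftrightarrow> (\<forall>i<n. Q (vs ! i))" for Q
    unfolding bij_betw_imp_surj_on[OF bij, symmetric] by auto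
  have ker: "x \<in> mat_kernel (adj_matrix G) \<longleftrightarrow> x \<in> carrier_vec n \<and>
      (\<forall>i<n. (\<Sum>j<n. adj_bit G (vs ! i) (vs ! j) * x $ j) = 0)" for x
    unfolding A by (auto simp: mat_kernel_def scalar_prod_def vec_eq_iff atLeast0LessThan)
  define idx where "idx = the_inv_into {..<n} ((!) vs)"
  have idx: "idx (vs ! i) = i" if "i < n" for i
    unfolding idx_def using that bij by (intro the_inv_into_f_f) (auto simp: bij_betw_def)
  define F where "F f = vec n (\<lambda>i. f (vs ! i))" for f :: "'a \<Rightarrow> bit"
  define F' where "F' x = (\<lambda>v. if v \<in> verts G then x $ idx v else 0)" for x :: "bit vec"
  have vsG: "vs ! i \<in> verts G" if "i < n" for i
    using that bij by (auto simp: bij_betw_def)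
  have "bij_betw F (null_space (verts G) (adj_bit G)) (mat_kernel (adj_matrix G))"
  proof (rule bij_betw_byWitness[where f' = F'])
    show "\<forall>f\<in>null_space (verts G) (adj_bit G). F' (F f) = f"
    proof
      fix f assume f: "f \<in> null_space (verts G) (adj_bit G)"
      have "\<forall>v\<in>verts G. F' (F f) v = f v"
        unfolding all_vs by (simp add: F_def F'_def idx vsG)
      then show "F' (F f) = f"
        using f by (auto simp: null_space_def F'_def fun_eq_iff)
    qed
    show "\<forall>x\<in>mat_kernel (adj_matrix G). F (F' x) = x"
      by (auto simp: ker F_def F'_def idx vsG vec_eq_iff)
    show "F ` null_space (verts G) (adj_bit G) \<subseteq> mat_kernel (adj_matrix G)"
      by (auto simp: ker F_def null_space_def sum_vs all_vs)
    show "F' ` mat_kernel (adj_matrix G) \<subseteq> null_space (verts G) (adj_bit G)"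
      by (auto simp: ker F'_def null_space_def sum_vs all_vs idx vsG)
  qed
  then show ?thesis
    using bij_betw_same_card by (fastforce simp: card_mat_kernel card_UNIV_bit graph_nullity_def)
qed

lemma card_null_space_induced:
  assumes "finite S"
  shows "card (null_space S (adj_bit G)) = 2 ^ graph_nullity (induced G S)"
proof -
  have "null_space S (adj_bit (induced G S)) = null_space S (adj_bit G)"
    by (auto simp: null_space_def adj_bit_def induced_def adjacent_def intro!: sum.cong)
  then show ?thesis
    using card_null_space_adj_bit[of "induced G S"] assms by (simp add: induced_def)
qed

lemma graph_rank_plus_nullity_induced:
  "finite S \<Longrightarrow> graph_rank (induced G S) + graph_nullity (induced G S) = card S"
  using graph_rank_plus_nullity[of "induced G S"] by (simp add: induced_def)

section \<open>Effect on the null space of adding one vertex\<close>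

lemma null_space_cong:
  assumes "\<And>v w. v \<in> S \<Longrightarrow> w \<in> S \<Longrightarrow> M v w = N v w"
  shows "null_space S M = null_space S N"
  using assms by (simp add: null_space_def)

lemma bordered_null_space_cong:
  assumes "\<And>v w. v \<in> T \<Longrightarrow> w \<in> T \<Longrightarrow> M v w = N v w" and "\<And>v. v \<in> T \<Longrightarrow> c v = d v"
  shows "bordered_null_space T c M = bordered_null_space T d N"
  using assms by (simp add: bordered_null_space_def)

text \<open>The block lemma with \<open>T = {a}\<close> and c = 1, b being the column of
  \<open>a\<close>. The block of \<open>a\<close> is a single zero, whose null space has two
  elements.\<close>

lemma card_null_space_insert_range:
  assumes "finite S" and "a \<notin> S"
    and "\<And>v w. M v w = M w v" and "\<And>v. v \<in> insert a S \<Longrightarrow> M v v = 0"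
    and "\<And>v. v \<in> S \<Longrightarrow> M v a = (\<Sum>w\<in>S. M v w * u w)"
  shows "card (null_space (insert a S) M) = 2 * card (null_space S M)"
proof -
  \<comment> \<open>Bordering the empty matrix leaves h unconstrained; this counts the null space of
    the zero block of \<open>a\<close>.\<close>
  have "bordered_null_space {} (\<lambda>_. 1) M = UNIV \<times> {\<lambda>_. 0}"
    by (auto simp: bordered_null_space_def)
  then have "card (null_space {a} M) = 2"
    using card_bordered_null_space[of "{}" a M "\<lambda>_. 1"] assms(4)
    by (simp add: card_UNIV_bit card_cartesian_product)
  moreover have "card (null_space (S \<union> {a}) M) = card (null_space S M) * card (null_space {a} M)"
  proof (rule card_null_space_Un_range[where u = u])
    show "M s t = M s a * 1" "M t s = M s a * 1" if "t \<in> {a}" for s t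
      using that assms(3)[of a s] by simp_all
  qed (use assms(1,2) in simp, use assms(1,2) in simp, use assms(2) in simp,
      rule assms(3), rule assms(4), simp, rule assms(5))
  ultimately show ?thesis
    by simp
qed

text \<open>Again the block lemma with \<open>T = {a}\<close> and c = 1. The bordered matrix has
  rows (0, 1) and (1, 0), so its null space is trivial.\<close>

lemma card_null_space_insert_not_range:
  assumes "finite S" and "a \<notin> S"
    and "\<And>v w. M v w = M w v" and "M a a = 0"
    and "z \<in> null_space S M" and "(\<Sum>v\<in>S. M v a * z v) = 1"
  shows "2 * card (null_space (insert a S) M) = card (null_space S M)"
proof -
  have "bordered_null_space {a} (\<lambda>_. 1) M = {(0, \<lambda>_. 0)}"
    by (auto simp: bordered_null_space_def fun_eq_iff)
  moreover have "2 * card (null_space (S \<union> {a}) M) =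
      card (null_space S M) * card (bordered_null_space {a} (\<lambda>_. 1) M)"
  proof (rule card_null_space_Un_not_range)
    show "M s t = M s a * 1" "M t s = M s a * 1" if "t \<in> {a}" for s t
      using that assms(3)[of a s] by simp_all
  qed (use assms(1,2) in simp, use assms(1,2) in simp, use assms(2) in simp,
      rule assms(3), rule assms(5), rule assms(6))
  ultimately show ?thesis
    by simp
qed

section \<open>Expansions of q over vertex subsets\<close>

definition rank_monomial :: "'r::comm_ring_1 \<Rightarrow> 'r \<Rightarrow> ('v, 'r) wgraph \<Rightarrow> 'v set \<Rightarrow> 'r" where
  "rank_monomial x y G S =
     (x - 1) ^ graph_rank (induced G S) * (y - 1) ^ graph_nullity (induced G S)"

text \<open>The ground set \<open>X\<close> is a parameter so that \<open>a\<close> can be left out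
  and the weight can factor over a disjoint union.\<close>

definition subset_weight :: "('v, 'r::comm_ring_1) wgraph \<Rightarrow> 'v set \<Rightarrow> 'v set \<Rightarrow> 'r" where
  "subset_weight G X S = (\<Prod>s\<in>S. \<alpha> G s) * (\<Prod>v\<in>X - S. \<beta> G v)"

lemma q_eq_sum:
  "q x y G = (\<Sum>S\<in>Pow (verts G). subset_weight G (verts G) S * rank_monomial x y G S)"
  by (simp add: q_def subset_weight_def rank_monomial_def mult.assoc)

lemma sum_Pow_insert:
  assumes "finite X" and "a \<notin> X"
  shows "(\<Sum>S\<in>Pow (insert a X). f S) = (\<Sum>S\<in>Pow X. f S + f (insert a S))"
proof -
  have "inj_on (insert a) (Pow X)"
    using assms(2) by (intro inj_onI) (metis PowD insert_ident subsetD)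
  moreover have "Pow X \<inter> insert a ` Pow X = {}"
    using assms(2) by auto
  ultimately show ?thesis
    using assms(1) by (simp add: Pow_insert sum.union_disjoint sum.reindex sum.distrib)
qed

lemma sum_Pow_Un:
  assumes "finite X" and "finite Y" and "X \<inter> Y = {}"
  shows "(\<Sum>S\<in>Pow (X \<union> Y). f S) = (\<Sum>S\<in>Pow X. \<Sum>T\<in>Pow Y. f (S \<union> T))"
proof -
  have "bij_betw (\<lambda>(S, T). S \<union> T) (Pow X \<times> Pow Y) (Pow (X \<union> Y))"
    using assms(3)
    by (intro bij_betw_byWitness[where f' = "\<lambda>U. (U \<inter> X, U \<inter> Y)"]) auto
  then show ?thesis
    by (simp add: sum.cartesian_product sum.reindex_bij_betw[symmetric] split_def)
qed

text \<open>Pairs each S avoiding \<open>a\<close> with \<open>insert a S\<close>; their weights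
  differ only in the factor at \<open>a\<close>. It is applied to H, where both factors are 1, and
  to the reweighted K.\<close>

lemma q_split_vertex:
  assumes "finite X" and "a \<notin> X" and "verts G = insert a X"
  shows "q x y G = (\<Sum>S\<in>Pow X. subset_weight G X S *
    (\<beta> G a * rank_monomial x y G S + \<alpha> G a * rank_monomial x y G (insert a S)))"
proof -
  have "subset_weight G (insert a X) S = \<beta> G a * subset_weight G X S"
    "subset_weight G (insert a X) (insert a S) = \<alpha> G a * subset_weight G X S"
    if "S \<subseteq> X" for S
  proof -
    have "insert a X - S = insert a (X - S)" "insert a X - insert a S = X - S" "a \<notin> S"
      and "finite S"
      using that assms(1,2) finite_subset by auto
    then show "subset_weight G (insert a X) S = \<beta> G a * subset_weight G X S"
      "subset_weight G (insert a X) (insert a S) = \<alpha> G a * subset_weight G X S"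
      using assms(1,2) by (simp_all add: subset_weight_def mult_ac)
  qed
  then show ?thesis
    unfolding q_eq_sum assms(3) sum_Pow_insert[OF assms(1,2)]
    by (auto simp: distrib_left mult_ac intro!: sum.cong)
qed

lemma q_delete_vertex:
  "q x y (delete_vertex G a) =
    (\<Sum>S\<in>Pow (verts G - {a}). subset_weight G (verts G - {a}) S * rank_monomial x y G S)"
proof -
  have "induced (delete_vertex G a) S = induced G S" if "S \<subseteq> verts G - {a}" for S
  proof -
    have "{e \<in> edges G. e \<subseteq> verts G - {a} \<and> e \<subseteq> S} = {e \<in> edges G. e \<subseteq> S}"
      using that by blast
    then show ?thesis
      by (simp add: induced_def delete_vertex_def)
  qed
  moreover have "verts (delete_vertex G a) = verts G - {a}"
    by (simp add: delete_vertex_def induced_def)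
  moreover have "subset_weight (delete_vertex G a) = subset_weight G"
    by (simp add: fun_eq_iff subset_weight_def delete_vertex_def induced_def)
  ultimately show ?thesis
    by (simp add: q_eq_sum rank_monomial_def)
qed

lemma rank_monomial_reweight:
  "rank_monomial x y (reweight G a s t) = rank_monomial x y G"
proof -
  have "adj_matrix (induced (reweight G a s t) S) = adj_matrix (induced G S)" for S
    by (simp add: adj_matrix_def vertex_list_def adjacent_def induced_def reweight_def)
  then show ?thesis
    by (simp add: fun_eq_iff rank_monomial_def graph_rank_def graph_nullity_def)
qed

section \<open>Monomials of a composition and the final linear system\<close>

lemma is_compositionD:
  assumes "is_composition a H K G"
  shows "adj_bit H a a = 0" and "adj_bit K a a = 0"
    and "s \<in> verts H - {a} \<Longrightarrow> s' \<in> verts H - {a} \<Longrightarrow> adj_bit G s s' = adj_bit H s s'"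
    and "t \<in> verts K - {a} \<Longrightarrow> t' \<in> verts K - {a} \<Longrightarrow> adj_bit G t t' = adj_bit K t t'"
    and "s \<in> verts H - {a} \<Longrightarrow> t \<in> verts K - {a} \<Longrightarrow> adj_bit G s t = adj_bit H s a * adj_bit K t a"
proof -
  have disj: "(verts H - {a}) \<inter> (verts K - {a}) = {}"
    using assms by (auto simp: is_composition_def)
  have edges: "edges G = {e \<in> edges H. e \<subseteq> verts H - {a}} \<union> {e \<in> edges K. e \<subseteq> verts K - {a}} \<union>
       {{v, w} | v w. v \<in> verts K - {a} \<and> adjacent K v a \<and>
                      w \<in> verts H - {a} \<and> adjacent H w a}"
    using assms unfolding is_composition_def delete_vertex_def induced_def by simp
  show "adj_bit H a a = 0" "adj_bit K a a = 0"
    using assms by (auto simp: is_composition_def looped_def adj_bit_def)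
  \<comment> \<open>As the two vertex sets without \<open>a\<close> are disjoint, only one of the
    three families of edges can contain a pair of the given kind. This also settles the two claims
    that follow.\<close>
  show "s \<in> verts H - {a} \<Longrightarrow> s' \<in> verts H - {a} \<Longrightarrow> adj_bit G s s' = adj_bit H s s'"
    using disj unfolding adj_bit_def adjacent_def edges by (auto simp: doubleton_eq_iff)
  show "t \<in> verts K - {a} \<Longrightarrow> t' \<in> verts K - {a} \<Longrightarrow> adj_bit G t t' = adj_bit K t t'"
    using disj unfolding adj_bit_def adjacent_def edges by (auto simp: doubleton_eq_iff)
  show "s \<in> verts H - {a} \<Longrightarrow> t \<in> verts K - {a} \<Longrightarrow> adj_bit G s t = adj_bit H s a * adj_bit K t a"
    using disj unfolding adj_bit_def adjacent_def edges by (auto simp: doubleton_eq_iff adjacent_def)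
qed

text \<open>
  Only one of \<open>p\<close> and \<open>r\<close> is nonzero: \<open>p\<close> if the neighbourhood vector of \<open>a\<close> in \<open>S\<close> lies outside the
  column space of the adjacency matrix of \<open>H[S]\<close>, and \<open>r\<close> if it lies inside.
\<close>

lemma rank_monomial_composition:
  fixes x y :: "'r::comm_ring_1"
  assumes comp: "is_composition a H K G"
    and no_loops: "\<forall>v \<in> verts H. \<not> looped H v"
    and S: "S \<subseteq> verts H - {a}"
  shows "\<exists>p r. rank_monomial x y H S = (y - 1) * p + r \<and>
    rank_monomial x y H (insert a S) = (x - 1)\<^sup>2 * p + (y - 1) * r \<and>
    (\<forall>T. T \<subseteq> verts K - {a} \<longrightarrow> rank_monomial x y G (S \<union> T) =
      p * rank_monomial x y K (insert a T) + r * rank_monomial x y K T)"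
proof -
  have aS: "a \<notin> S" and finS: "finite S" and aH: "a \<in> verts H" and finK: "finite (verts K)"
    using S comp finite_subset by (auto simp: is_composition_def is_wgraph_def)
  have zero_diag: "adj_bit H v v = 0" if "v \<in> insert a S" for v
    using no_loops S that aH by (auto simp: adj_bit_def looped_def)
  let ?b = "\<lambda>s. adj_bit H s a" and ?c = "\<lambda>t. adj_bit K t a"
  note card_null = card_null_space_induced
  note rn = graph_rank_plus_nullity_induced
  have T: "finite T" "a \<notin> T" "S \<inter> T = {}" "card (S \<union> T) = card S + card T"
    "\<And>v w. v \<in> S \<Longrightarrow> w \<in> S \<Longrightarrow> adj_bit G v w = adj_bit H v w"
    "\<And>s t. s \<in> S \<Longrightarrow> t \<in> T \<Longrightarrow> adj_bit G s t = ?b s * ?c t"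
    "\<And>s t. s \<in> S \<Longrightarrow> t \<in> T \<Longrightarrow> adj_bit G t s = ?b s * ?c t"
    "null_space S (adj_bit G) = null_space S (adj_bit H)"
    "null_space T (adj_bit G) = null_space T (adj_bit K)"
    "bordered_null_space T ?c (adj_bit G) = bordered_null_space T ?c (adj_bit K)"
    if "T \<subseteq> verts K - {a}" for T
  proof -
    show fin: "finite T"
      using finite_subset[OF that] finK by simp
    show "a \<notin> T" and disj: "S \<inter> T = {}"
      using that S comp by (auto simp: is_composition_def)
    show "card (S \<union> T) = card S + card T"
      using finS fin disj by (rule card_Un_disjoint)
    show SS: "adj_bit G v w = adj_bit H v w" if "v \<in> S" "w \<in> S" for v w
      using is_compositionD(3)[OF comp] S that by blast
    have TT: "adj_bit G v w = adj_bit K v w" if "v \<in> T" "w \<in> T" for v w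
      using is_compositionD(4)[OF comp] \<open>T \<subseteq> _\<close> that by blast
    show ST: "adj_bit G s t = ?b s * ?c t" if "s \<in> S" "t \<in> T" for s t
      using is_compositionD(5)[OF comp] S \<open>T \<subseteq> _\<close> that by blast
    show "adj_bit G t s = ?b s * ?c t" if "s \<in> S" "t \<in> T" for s t
      using ST[OF that] by (simp add: adj_bit_commute)
    show "null_space S (adj_bit G) = null_space S (adj_bit H)"
      "null_space T (adj_bit G) = null_space T (adj_bit K)"
      "bordered_null_space T ?c (adj_bit G) = bordered_null_space T ?c (adj_bit K)"
      using SS TT by (auto intro!: null_space_cong bordered_null_space_cong)
  qed
  show ?thesis
  proof (cases "\<exists>z\<in>null_space S (adj_bit H). (\<Sum>v\<in>S. ?b v * z v) = 1")
    case True
    then obtain z where z: "z \<in> null_space S (adj_bit H)" "(\<Sum>v\<in>S. ?b v * z v) = 1"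
      by blast
    have "2 * card (null_space (insert a S) (adj_bit H)) = card (null_space S (adj_bit H))"
      using finS aS adj_bit_commute is_compositionD(1)[OF comp] z
      by (rule card_null_space_insert_not_range)
    then have "(2::nat) ^ Suc (graph_nullity (induced H (insert a S))) = 2 ^ graph_nullity (induced H S)"
      using finS by (simp add: card_null)
    then have nH: "graph_nullity (induced H S) = Suc (graph_nullity (induced H (insert a S)))"
      using power_inject_exp by (metis one_less_numeral_iff semiring_norm(76))
    \<comment> \<open>One vertex more and nullity one less.\<close>
    have rH: "graph_rank (induced H (insert a S)) = graph_rank (induced H S) + 2"
      using rn[of S H] rn[of "insert a S" H] finS aS nH by simp
    \<comment> \<open>The common factor of the two monomials: that of S is (y - 1) p and that of S
      with \<open>a\<close> is (x - 1)^2 p.\<close>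
    define p where "p = (x - 1) ^ graph_rank (induced H S) *
      (y - 1) ^ graph_nullity (induced H (insert a S))"
    have "rank_monomial x y G (S \<union> T) = p * rank_monomial x y K (insert a T)"
      if TK: "T \<subseteq> verts K - {a}" for T
    proof -
      note T = T[OF TK]
      have "2 * card (null_space (S \<union> T) (adj_bit G)) =
          card (null_space S (adj_bit G)) * card (bordered_null_space T ?c (adj_bit G))"
        using finS T(1,3) adj_bit_commute T(6,7) z[folded T(8)]
        by (rule card_null_space_Un_not_range)
      also have "card (bordered_null_space T ?c (adj_bit G)) = card (null_space (insert a T) (adj_bit K))"
        unfolding T(10) using T(1,2) is_compositionD(2)[OF comp] adj_bit_commute
        by (rule card_bordered_null_space) auto
      finally have "(2::nat) ^ Suc (graph_nullity (induced G (S \<union> T))) =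
          2 ^ (graph_nullity (induced H S) + graph_nullity (induced K (insert a T)))"
        using finS T(1) unfolding T(8) by (simp add: card_null power_add)
      then have nG: "Suc (graph_nullity (induced G (S \<union> T))) =
          graph_nullity (induced H S) + graph_nullity (induced K (insert a T))"
        using power_inject_exp by (metis one_less_numeral_iff semiring_norm(76))
      \<comment> \<open>The set on the left has one vertex fewer than S and
        \<open>insert a T\<close> together; this offsets the \<open>Suc\<close> in the nullities, so
        the ranks add.\<close>
      then have "graph_rank (induced G (S \<union> T)) =
          graph_rank (induced H S) + graph_rank (induced K (insert a T))"
        using rn[of S H] rn[of "insert a T" K] rn[of "S \<union> T" G] finS T(1-4) by simp
      then show ?thesis
        using nG nH by (simp add: rank_monomial_def p_def power_add mult_ac)
    qed
    then show ?thesis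
      by (intro exI[of _ p] exI[of _ 0])
        (simp add: rank_monomial_def p_def nH rH power_add power2_eq_square mult_ac)
  next
    case False
    \<comment> \<open>Over GF(2) a value other than 1 is 0, so the neighbourhood vector annihilates
      the whole kernel and duality applies.\<close>
    then have "(\<Sum>v\<in>S. ?b v * z v) = 0" if "z \<in> null_space S (adj_bit H)" for z
      using that by auto
    with finS adj_bit_commute have "\<exists>u. \<forall>v\<in>S. ?b v = (\<Sum>w\<in>S. adj_bit H v w * u w)"
      by (rule symmetric_range_eq_annihilator)
    then obtain u where "\<forall>v\<in>S. ?b v = (\<Sum>w\<in>S. adj_bit H v w * u w)"
      by blast
    then have u: "?b v = (\<Sum>w\<in>S. adj_bit H v w * u w)" if "v \<in> S" for v
      using that by blast
    have "card (null_space (insert a S) (adj_bit H)) = 2 * card (null_space S (adj_bit H))"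
      using finS aS adj_bit_commute zero_diag u by (rule card_null_space_insert_range)
    then have "(2::nat) ^ graph_nullity (induced H (insert a S)) = 2 ^ Suc (graph_nullity (induced H S))"
      using finS by (simp add: card_null)
    then have nH: "graph_nullity (induced H (insert a S)) = Suc (graph_nullity (induced H S))"
      using power_inject_exp by (metis one_less_numeral_iff semiring_norm(76))
    have rH: "graph_rank (induced H (insert a S)) = graph_rank (induced H S)"
      using rn[of S H] rn[of "insert a S" H] finS aS nH by simp
    have "rank_monomial x y G (S \<union> T) = rank_monomial x y H S * rank_monomial x y K T"
      if TK: "T \<subseteq> verts K - {a}" for T
    proof -
      note T = T[OF TK]
      have "card (null_space (S \<union> T) (adj_bit G)) =
          card (null_space S (adj_bit G)) * card (null_space T (adj_bit G))"
        using finS T(1,3) adj_bit_commute T(6,7)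
      proof (rule card_null_space_Un_range)
        show "adj_bit G v v = 0" if "v \<in> S" for v
          using T(5)[OF that that] zero_diag that by simp
        show "?b v = (\<Sum>w\<in>S. adj_bit G v w * u w)" if "v \<in> S" for v
          unfolding u[OF that] using T(5)[OF that] by simp
      qed
      then have "(2::nat) ^ graph_nullity (induced G (S \<union> T)) =
          2 ^ (graph_nullity (induced H S) + graph_nullity (induced K T))"
        using finS T(1) unfolding T(8,9) by (simp add: card_null power_add)
      then have nG: "graph_nullity (induced G (S \<union> T)) =
          graph_nullity (induced H S) + graph_nullity (induced K T)"
        using power_inject_exp by (metis one_less_numeral_iff semiring_norm(76))
      then have "graph_rank (induced G (S \<union> T)) =
          graph_rank (induced H S) + graph_rank (induced K T)"
        using rn[of S H] rn[of T K] rn[of "S \<union> T" G] finS T(1-4) by simp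
      then show ?thesis
        using nG by (simp add: rank_monomial_def power_add mult_ac)
    qed
    \<comment> \<open>Here r is the monomial of H[S] itself; adding \<open>a\<close> keeps the rank
      and raises the nullity by one, which multiplies it by y - 1.\<close>
    then show ?thesis
      by (intro exI[of _ 0] exI[of _ "rank_monomial x y H S"])
        (simp add: rank_monomial_def nH rH mult_ac)
  qed
qed

theorem theorem8:
  fixes x y d :: "'r::comm_ring_1"
    and H K G :: "('v, 'r) wgraph"
    and a :: 'v
  assumes inverse: "d * ((x - 1)\<^sup>2 - (y - 1)\<^sup>2) = 1"
    and "is_wgraph H"
    and no_loops: "\<forall>v \<in> verts H. \<not> looped H v"
    and "a \<in> verts H" and "\<alpha> H a = 1" and "\<beta> H a = 1"
    and "is_wgraph K"
    and "is_composition a H K G"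
  shows "q x y G =
    q x y (reweight K a
      ((q x y H - y * q x y (delete_vertex H a)) * d)
      ((((x - 1)\<^sup>2 + y - 1) * q x y (delete_vertex H a) - (y - 1) * q x y H) * d))"
proof -
  note comp = \<open>is_composition a H K G\<close>
  define X Y where "X = verts H - {a}" and "Y = verts K - {a}"
  have X: "finite X" "a \<notin> X" "verts H = insert a X"
    and Y: "finite Y" "a \<notin> Y" "verts K = insert a Y"
    and XY: "X \<inter> Y = {}" "verts G = X \<union> Y"
    using comp by (auto simp: X_def Y_def is_composition_def is_wgraph_def)
  have "\<exists>p r. rank_monomial x y H S = (y - 1) * p + r \<and>
    rank_monomial x y H (insert a S) = (x - 1)\<^sup>2 * p + (y - 1) * r \<and>
    (\<forall>T. T \<subseteq> Y \<longrightarrow> rank_monomial x y G (S \<union> T) =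
      p * rank_monomial x y K (insert a T) + r * rank_monomial x y K T)" if "S \<subseteq> X" for S
    using rank_monomial_composition[OF comp no_loops that[unfolded X_def]] unfolding Y_def .
  \<comment> \<open>The coefficients depend on S but not on T, so the sum over S can be carried out
    first and leaves only two constants.\<close>
  then obtain p r where
      pr1: "\<And>S. S \<subseteq> X \<Longrightarrow> rank_monomial x y H S = (y - 1) * p S + r S"
    and pr2: "\<And>S. S \<subseteq> X \<Longrightarrow>
      rank_monomial x y H (insert a S) = (x - 1)\<^sup>2 * p S + (y - 1) * r S"
    and pr3: "\<And>S T. S \<subseteq> X \<Longrightarrow> T \<subseteq> Y \<Longrightarrow> rank_monomial x y G (S \<union> T) =
      p S * rank_monomial x y K (insert a T) + r S * rank_monomial x y K T"
    by metis
  \<comment> \<open>\<open>P\<close> and \<open>R\<close> collect the coefficients of the terms of K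
    with and without \<open>a\<close>; they turn out to be the two new weights of
    \<open>a\<close>.\<close>
  define P where "P = (\<Sum>S\<in>Pow X. subset_weight H X S * p S)"
  define R where "R = (\<Sum>S\<in>Pow X. subset_weight H X S * r S)"
  have qHa: "q x y (delete_vertex H a) = (y - 1) * P + R"
    unfolding q_delete_vertex X_def[symmetric] P_def R_def sum_distrib_left sum.distrib[symmetric]
    by (intro sum.cong) (auto simp: pr1 algebra_simps)
  have "q x y H = (\<Sum>S\<in>Pow X. subset_weight H X S *
      (((x - 1)\<^sup>2 + y - 1) * p S + y * r S))"
    unfolding q_split_vertex[OF X] using assms(5,6)
    by (intro sum.cong) (auto simp: pr1 pr2 algebra_simps)
  also have "\<dots> = ((x - 1)\<^sup>2 + y - 1) * P + y * R"
    unfolding P_def R_def sum_distrib_left sum.distrib[symmetric]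
    by (intro sum.cong) (auto simp: algebra_simps)
  finally have qH: "q x y H = ((x - 1)\<^sup>2 + y - 1) * P + y * R" .
  \<comment> \<open>Eliminate \<open>R\<close> from \<open>qH\<close> and \<open>qHa\<close>: the
    coefficient of \<open>P\<close> becomes (x - 1)^2 + (y - 1) - y (y - 1), which is the invertible
    element of the hypothesis.\<close>
  have "(q x y H - y * q x y (delete_vertex H a)) * d = P * (d * ((x - 1)\<^sup>2 - (y - 1)\<^sup>2))"
    unfolding qH qHa by (simp add: algebra_simps power2_eq_square)
  then have sP: "(q x y H - y * q x y (delete_vertex H a)) * d = P"
    using inverse by simp
  \<comment> \<open>Eliminating \<open>P\<close> instead leaves \<open>R\<close> with the same
    coefficient.\<close>
  have "(((x - 1)\<^sup>2 + y - 1) * q x y (delete_vertex H a) - (y - 1) * q x y H) * d =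
      R * (d * ((x - 1)\<^sup>2 - (y - 1)\<^sup>2))"
    unfolding qH qHa by (simp add: algebra_simps power2_eq_square)
  then have tR: "(((x - 1)\<^sup>2 + y - 1) * q x y (delete_vertex H a) - (y - 1) * q x y H) * d = R"
    using inverse by simp
  have weight: "subset_weight G (X \<union> Y) (S \<union> T) = subset_weight H X S * subset_weight K Y T"
    if "S \<subseteq> X" "T \<subseteq> Y" for S T
  proof -
    have fin: "finite S" "finite T" "S \<inter> T = {}" "(X - S) \<inter> (Y - T) = {}"
      and diff: "X \<union> Y - (S \<union> T) = (X - S) \<union> (Y - T)"
      using that X(1) Y(1) XY finite_subset by blast+
    have wH: "\<alpha> G v = \<alpha> H v" "\<beta> G v = \<beta> H v" if "v \<in> X" for v
      using comp that by (auto simp: is_composition_def X_def)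
    have wK: "\<alpha> G v = \<alpha> K v" "\<beta> G v = \<beta> K v" if "v \<in> Y" for v
      using comp that by (auto simp: is_composition_def Y_def)
    have "prod (\<alpha> G) S = prod (\<alpha> H) S" "prod (\<beta> G) (X - S) = prod (\<beta> H) (X - S)"
      "prod (\<alpha> G) T = prod (\<alpha> K) T" "prod (\<beta> G) (Y - T) = prod (\<beta> K) (Y - T)"
      using that wH wK by (auto intro!: prod.cong)
    then show ?thesis
      unfolding subset_weight_def diff
      using fin X(1) Y(1) by (simp add: prod.union_disjoint mult_ac)
  qed
  have "q x y G = (\<Sum>S\<in>Pow X. \<Sum>T\<in>Pow Y. subset_weight H X S * subset_weight K Y T *
      (p S * rank_monomial x y K (insert a T) + r S * rank_monomial x y K T))"
    unfolding q_eq_sum XY(2) sum_Pow_Un[OF X(1) Y(1) XY(1)]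
    by (intro sum.cong) (auto simp: weight pr3)
  \<comment> \<open>Exchange the two sums; the inner sum over S is then \<open>R\<close> or
    \<open>P\<close>.\<close>
  also have "\<dots> = (\<Sum>T\<in>Pow Y. subset_weight K Y T *
      (R * rank_monomial x y K T + P * rank_monomial x y K (insert a T)))"
    unfolding P_def R_def sum_distrib_left sum_distrib_right sum.distrib[symmetric]
    by (subst sum.swap, intro sum.cong) (auto simp: algebra_simps)
  also have "\<dots> = q x y (reweight K a P R)"
  proof -
    \<comment> \<open>Reweighting alters only the weights at \<open>a\<close>, which lies outside
      \<open>Y\<close>.\<close>
    have "subset_weight (reweight K a P R) Y T = subset_weight K Y T" if "T \<subseteq> Y" for T
      using Y(2) that unfolding subset_weight_def reweight_def
      by (auto intro!: arg_cong2[of _ _ _ _ "(*)"] prod.cong)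
    moreover have "verts (reweight K a P R) = insert a Y"
      "\<alpha> (reweight K a P R) a = P" "\<beta> (reweight K a P R) a = R"
      using Y(3) by (simp_all add: reweight_def)
    ultimately show ?thesis
      using q_split_vertex[of Y a "reweight K a P R" x y] Y
      by (simp add: rank_monomial_reweight)
  qed
  finally show ?thesis
    unfolding sP tR .
qed

end
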